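(* Let $\theta\in\mathbb R$. Then $\theta\in\mathbb Q$ if and only if ${\rm Spec}(\theta)=\mathbb P_\varepsilon^2$.
   Context: Fix a nonprincipal ultrafilter $\mathfrak u$ on $\mathbb N$, and let ${}^*\mathbb Z\subset{}^*\mathbb R$ be the ultrapowers of $\mathbb Z\subset\mathbb R$. Let ${}^*\mathbb R_{\rm fin}$ be the ring of bounded elements, ${}^*\mathbb R_\varepsilon$ its ideal of infinitesimals, and $({}^*\mathbb R_{\rm fin})^\times_+$ the multiplicative group of positive elements that are neither infinite nor infinitesimal. Let $\mathbb P:=({}^*\mathbb R_{>0}\cup\{0\})/({}^*\mathbb R_{\rm fin})^\times_+$; write $\langle x\rangle\in\mathbb P$ for the class of $|x|$, and $-\infty:=\langle0\rangle$. $\mathbb P$ has the induced product and total order ($\mu<\mu'$ iff $x<x'$ for all representatives; $-\infty$ is the minimum). $\mathbb P_\varepsilon\subset\mathbb P$ is the set of classes of positive infinitesimals. For $0\ne n\in{}^*\mathbb Z$ the growth is $\mu(n):=\langle n\rangle^{-1}$. For $\theta\in\mathbb R$, ${}^*\mathbb Z(\theta)$ is the group of $n\in{}^*\mathbb Z$ for which there is a (unique) $n^\perp\in{}^*\mathbb Z$ with $\varepsilon(n):=n\theta-n^\perp\in{}^*\mathbb R_\varepsilon$; the decay of $n\in{}^*\mathbb Z(\theta)$ is $\nu(n):=\langle\varepsilon(n)\rangle$. For $\mu,\nu\in\mathbb P_\varepsilon$ let $${}^*\mathbb Z^\mu_\nu(\theta):=\{0\neq n\in{}^*\mathbb Z(\theta):\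 \mu(n)>\mu,\ \nu(n)\le\nu\}\cup\{0\},$$ a subgroup of ${}^*\mathbb Z(\theta)$. The nonvanishing spectrum is ${\rm Spec}(\theta):=\{(\mu,\nu)\in\mathbb P_\varepsilon^2:\ {}^*\mathbb Z^\mu_\nu(\theta)\ne0\}$. *)

theory Defs
  imports Complex_Main "HOL-Library.FuncSet"
begin

definition nonprincipal_ultrafilter :: "'a filter \<Rightarrow> bool" where
  "nonprincipal_ultrafilter u \<longleftrightarrow>
     u \<noteq> bot \<and>
     (\<forall>P. eventually P u \<or> eventually (\<lambda>i. \<not> P i) u) \<and>
     (\<forall>A. u \<noteq> principal A)"

text \<open>
  The ultrafilter \<open>u\<close> is a parameter throughout, so the ultrapower is a set of equivalence classes
  of sequences rather than a type. The ultrapower of a subset \<open>A\<close> consists of the classes of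
  \<open>A\<close>-valued sequences, which makes it a subset of the ultrapower of \<open>UNIV\<close>.
\<close>

definition urel :: "nat filter \<Rightarrow> ((nat \<Rightarrow> 'a) \<times> (nat \<Rightarrow> 'a)) set" where
  "urel u = {(x, y). eventually (\<lambda>i. x i = y i) u}"

definition ucls :: "nat filter \<Rightarrow> (nat \<Rightarrow> 'a) \<Rightarrow> (nat \<Rightarrow> 'a) set" where
  "ucls u x = urel u `` {x}"

definition ultrapower :: "nat filter \<Rightarrow> 'a set \<Rightarrow> (nat \<Rightarrow> 'a) set set" where
  "ultrapower u A = (UNIV \<rightarrow> A) // urel u"

type_synonym hyperreal = "(nat \<Rightarrow> real) set"

definition hreals :: "nat filter \<Rightarrow> hyperreal set" where
  "hreals u = ultrapower u UNIV"

definition hints :: "nat filter \<Rightarrow> hyperreal set" where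
  "hints u = ultrapower u \<int>"

definition hconst :: "nat filter \<Rightarrow> real \<Rightarrow> hyperreal" where
  "hconst u r = ucls u (\<lambda>_. r)"

definition lift1 :: "nat filter \<Rightarrow> (real \<Rightarrow> real) \<Rightarrow> hyperreal \<Rightarrow> hyperreal" where
  "lift1 u f X = (\<Union>x\<in>X. ucls u (\<lambda>i. f (x i)))"

definition lift2 :: "nat filter \<Rightarrow> (real \<Rightarrow> real \<Rightarrow> real) \<Rightarrow> hyperreal \<Rightarrow> hyperreal \<Rightarrow> hyperreal" where
  "lift2 u f X Y = (\<Union>x\<in>X. \<Union>y\<in>Y. ucls u (\<lambda>i. f (x i) (y i)))"

definition hless :: "nat filter \<Rightarrow> hyperreal \<Rightarrow> hyperreal \<Rightarrow> bool" where
  "hless u X Y \<longleftrightarrow> (\<exists>x\<in>X. \<exists>y\<in>Y. eventually (\<lambda>i. x i < y i) u)"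

abbreviation hmult :: "nat filter \<Rightarrow> hyperreal \<Rightarrow> hyperreal \<Rightarrow> hyperreal" where
  "hmult u \<equiv> lift2 u (*)"

abbreviation hminus :: "nat filter \<Rightarrow> hyperreal \<Rightarrow> hyperreal \<Rightarrow> hyperreal" where
  "hminus u \<equiv> lift2 u (-)"

abbreviation habs :: "nat filter \<Rightarrow> hyperreal \<Rightarrow> hyperreal" where
  "habs u \<equiv> lift1 u abs"

abbreviation hinverse :: "nat filter \<Rightarrow> hyperreal \<Rightarrow> hyperreal" where
  "hinverse u \<equiv> lift1 u inverse"

definition hfinite :: "nat filter \<Rightarrow> hyperreal set" where
  "hfinite u = {X \<in> hreals u. \<exists>r. hless u (habs u X) (hconst u r)}"

definition hinfinitesimal :: "nat filter \<Rightarrow> hyperreal set" where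
  "hinfinitesimal u = {X \<in> hreals u. \<forall>r>0. hless u (habs u X) (hconst u r)}"

definition hpos :: "nat filter \<Rightarrow> hyperreal set" where
  "hpos u = {X \<in> hreals u. hless u (hconst u 0) X}"

definition hfin_units_pos :: "nat filter \<Rightarrow> hyperreal set" where
  "hfin_units_pos u = hpos u \<inter> (hfinite u - hinfinitesimal u)"

definition orbit :: "nat filter \<Rightarrow> hyperreal \<Rightarrow> hyperreal set" where
  "orbit u X = hmult u X ` hfin_units_pos u"

definition PP :: "nat filter \<Rightarrow> hyperreal set set" where
  "PP u = orbit u ` (hpos u \<union> {hconst u 0})"

definition PP_eps :: "nat filter \<Rightarrow> hyperreal set set" where
  "PP_eps u = orbit u ` (hpos u \<inter> hinfinitesimal u)"

definition pclass :: "nat filter \<Rightarrow> hyperreal \<Rightarrow> hyperreal set" where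
  "pclass u X = orbit u (habs u X)"

definition pless :: "nat filter \<Rightarrow> hyperreal set \<Rightarrow> hyperreal set \<Rightarrow> bool" where
  "pless u M M' \<longleftrightarrow> (\<forall>X\<in>M. \<forall>X'\<in>M'. hless u X X')"

definition pleq :: "nat filter \<Rightarrow> hyperreal set \<Rightarrow> hyperreal set \<Rightarrow> bool" where
  "pleq u M M' \<longleftrightarrow> pless u M M' \<or> M = M'"

definition pmult :: "nat filter \<Rightarrow> hyperreal set \<Rightarrow> hyperreal set \<Rightarrow> hyperreal set" where
  "pmult u M M' = {hmult u X X' |X X'. X \<in> M \<and> X' \<in> M'}"

text \<open>
  The inverse for the product induced on the quotient, see \<open>pinverse_orbit\<close> and \<open>pmult_pinverse\<close>
  below; meaningful for classes other than the class of \<open>0\<close>.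
\<close>

definition pinverse :: "nat filter \<Rightarrow> hyperreal set \<Rightarrow> hyperreal set" where
  "pinverse u M = hinverse u ` M"

definition growth :: "nat filter \<Rightarrow> hyperreal \<Rightarrow> hyperreal set" where
  "growth u n = pinverse u (pclass u n)"

definition hints_approx :: "nat filter \<Rightarrow> real \<Rightarrow> hyperreal set" where
  "hints_approx u \<theta> =
     {n \<in> hints u. \<exists>m\<in>hints u. hminus u (hmult u n (hconst u \<theta>)) m \<in> hinfinitesimal u}"

definition perp :: "nat filter \<Rightarrow> real \<Rightarrow> hyperreal \<Rightarrow> hyperreal" where
  "perp u \<theta> n =
     (THE m. m \<in> hints u \<and> hminus u (hmult u n (hconst u \<theta>)) m \<in> hinfinitesimal u)"

definition err :: "nat filter \<Rightarrow> real \<Rightarrow> hyperreal \<Rightarrow> hyperreal" where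
  "err u \<theta> n = hminus u (hmult u n (hconst u \<theta>)) (perp u \<theta> n)"

definition decay :: "nat filter \<Rightarrow> real \<Rightarrow> hyperreal \<Rightarrow> hyperreal set" where
  "decay u \<theta> n = pclass u (err u \<theta> n)"

definition growth_decay_group ::
    "nat filter \<Rightarrow> real \<Rightarrow> hyperreal set \<Rightarrow> hyperreal set \<Rightarrow> hyperreal set" where
  "growth_decay_group u \<theta> \<mu> \<nu> =
     {n \<in> hints_approx u \<theta>. n \<noteq> hconst u 0 \<and> pless u \<mu> (growth u n) \<and> pleq u (decay u \<theta> n) \<nu>}
     \<union> {hconst u 0}"

definition Spec :: "nat filter \<Rightarrow> real \<Rightarrow> (hyperreal set \<times> hyperreal set) set" where
  "Spec u \<theta> =
     {(\<mu>, \<nu>) \<in> PP_eps u \<times> PP_eps u. growth_decay_group u \<theta> \<mu> \<nu> \<noteq> {hconst u 0}}"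

lemma equiv_urel: "equiv UNIV (urel u)"
  by (rule equivI) (auto simp: urel_def refl_on_def sym_def trans_def eq_commute elim: eventually_elim2)

lemma ucls_eq_iff: "ucls u x = ucls u y \<longleftrightarrow> eventually (\<lambda>i. x i = y i) u"
  unfolding ucls_def using eq_equiv_class_iff[OF equiv_urel] by (auto simp: urel_def)

lemma mem_ucls: "y \<in> ucls u x \<longleftrightarrow> eventually (\<lambda>i. x i = y i) u"
  by (simp add: ucls_def urel_def)

lemma ucls_refl [simp]: "x \<in> ucls u x"
  by (simp add: mem_ucls)

lemma hreals_eq: "hreals u = range (ucls u)"
  by (auto simp: hreals_def ultrapower_def quotient_def ucls_def)

lemma hints_eq: "hints u = ucls u ` (UNIV \<rightarrow> \<int>)"
  by (auto simp: hints_def ultrapower_def quotient_def ucls_def)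

lemma lift1_ucls [simp]: "lift1 u f (ucls u x) = ucls u (\<lambda>i. f (x i))"
proof -
  have "ucls u (\<lambda>i. f (y i)) = ucls u (\<lambda>i. f (x i))" if "y \<in> ucls u x" for y
    using that unfolding ucls_eq_iff mem_ucls by (rule eventually_mono) simp
  then show ?thesis unfolding lift1_def using ucls_refl by blast
qed

lemma lift2_ucls [simp]: "lift2 u f (ucls u x) (ucls u y) = ucls u (\<lambda>i. f (x i) (y i))"
proof -
  have "ucls u (\<lambda>i. f (a i) (b i)) = ucls u (\<lambda>i. f (x i) (y i))"
    if "a \<in> ucls u x" "b \<in> ucls u y" for a b
    using that unfolding ucls_eq_iff mem_ucls by (rule eventually_elim2) simp
  then show ?thesis unfolding lift2_def using ucls_refl by blast
qed

lemma hless_ucls [simp]: "hless u (ucls u x) (ucls u y) \<longleftrightarrow> eventually (\<lambda>i. x i < y i) u"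
proof
  assume "hless u (ucls u x) (ucls u y)"
  then obtain a b where "eventually (\<lambda>i. x i = a i) u" "eventually (\<lambda>i. y i = b i) u"
    "eventually (\<lambda>i. a i < b i) u"
    by (auto simp: hless_def mem_ucls)
  then show "eventually (\<lambda>i. x i < y i) u" by eventually_elim simp
qed (auto simp: hless_def intro: ucls_refl)

lemma perp_unique:
  assumes u: "nonprincipal_ultrafilter u"
    and m: "m \<in> hints u" "hminus u (hmult u n (hconst u \<theta>)) m \<in> hinfinitesimal u"
    and m': "m' \<in> hints u" "hminus u (hmult u n (hconst u \<theta>)) m' \<in> hinfinitesimal u"
    and n: "n \<in> hreals u"
  shows "m = m'"
proof -
  obtain x y z where eqs: "n = ucls u z" "m = ucls u x" "m' = ucls u y"
    and Pi: "x \<in> UNIV \<rightarrow> \<int>" "y \<in> UNIV \<rightarrow> \<int>"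
    using m(1) m'(1) n unfolding hints_eq hreals_eq by blast
  have ints: "x i \<in> \<int>" "y i \<in> \<int>" for i
    using Pi by auto
  have "eventually (\<lambda>i. \<bar>z i * \<theta> - x i\<bar> < 1/2) u" "eventually (\<lambda>i. \<bar>z i * \<theta> - y i\<bar> < 1/2) u"
    using m(2)[unfolded hinfinitesimal_def] m'(2)[unfolded hinfinitesimal_def]
    by (auto simp: eqs hconst_def dest!: spec[of _ "1/2"])
  then have "eventually (\<lambda>i. x i = y i) u"
  proof eventually_elim
    case (elim i)
    then have "\<bar>x i - y i\<bar> < 1" by linarith
    then show ?case using ints[of i] Ints_eq_abs_less1 by blast
  qed
  then show ?thesis by (simp add: eqs ucls_eq_iff)
qed

lemma hfin_units_pos_ucls:
  assumes u: "nonprincipal_ultrafilter u"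
  shows "ucls u x \<in> hfin_units_pos u \<longleftrightarrow>
    (\<exists>a>0. \<exists>b>0. eventually (\<lambda>i. a \<le> x i \<and> x i \<le> b) u)" (is "?L \<longleftrightarrow> ?R")
proof
  have nb: "u \<noteq> bot" and alt: "\<And>P. eventually P u \<or> eventually (\<lambda>i. \<not> P i) u"
    using u by (auto simp: nonprincipal_ultrafilter_def)
  show ?R if ?L
  proof -
    from that obtain r s where s: "s > 0" "\<not> eventually (\<lambda>i. \<bar>x i\<bar> < s) u"
      and r: "eventually (\<lambda>i. \<bar>x i\<bar> < r) u" and p: "eventually (\<lambda>i. 0 < x i) u"
      by (auto simp: hfin_units_pos_def hpos_def hfinite_def hinfinitesimal_def hreals_eq hconst_def)
    from s(2) alt have "eventually (\<lambda>i. \<not> \<bar>x i\<bar> < s) u" by blast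
    with r p have "eventually (\<lambda>i. s \<le> x i \<and> x i \<le> max r 1) u" by eventually_elim auto
    then show ?R using s(1) by (intro exI[of _ s] exI[of _ "max r 1"] conjI) auto
  qed
  show ?L if ?R
  proof -
    from that obtain a b where ab: "a > 0" "b > 0" and ev: "eventually (\<lambda>i. a \<le> x i \<and> x i \<le> b) u"
      by blast
    have "eventually (\<lambda>i. 0 < x i) u" "eventually (\<lambda>i. \<bar>x i\<bar> < b + 1) u"
      using ev ab by (auto elim!: eventually_mono)
    moreover have "\<not> eventually (\<lambda>i. \<bar>x i\<bar> < a) u"
    proof
      assume "eventually (\<lambda>i. \<bar>x i\<bar> < a) u"
      with ev have "eventually (\<lambda>i. False) u" by eventually_elim auto
      then show False using nb by (simp add: trivial_limit_def)
    qed
    ultimately show ?L using ab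
      by (auto simp: hfin_units_pos_def hpos_def hfinite_def hinfinitesimal_def hreals_eq hconst_def)
  qed
qed

lemma pinverse_orbit:
  assumes u: "nonprincipal_ultrafilter u" and X: "X \<in> hreals u"
  shows "pinverse u (orbit u X) = orbit u (hinverse u X)"
proof -
  have inv: "hinverse u Y \<in> hfin_units_pos u" if Y: "Y \<in> hfin_units_pos u" for Y
  proof -
    obtain y where y: "Y = ucls u y" using Y by (auto simp: hfin_units_pos_def hpos_def hreals_eq)
    with Y u obtain a b where ab: "a > 0" "b > 0"
      and ev: "eventually (\<lambda>i. a \<le> y i \<and> y i \<le> b) u" by (auto simp: hfin_units_pos_ucls)
    have "eventually (\<lambda>i. inverse b \<le> inverse (y i) \<and> inverse (y i) \<le> inverse a) u"
      using ev by eventually_elim (use ab in \<open>auto intro!: le_imp_inverse_le\<close>)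
    moreover have "inverse a > 0" "inverse b > 0" using ab by simp_all
    ultimately show ?thesis unfolding y lift1_ucls hfin_units_pos_ucls[OF u] by blast
  qed
  have inv2: "hinverse u (hinverse u Y) = Y" if "Y \<in> hreals u" for Y
    using that by (auto simp: hreals_eq)
  have mult: "hinverse u (hmult u X Y) = hmult u (hinverse u X) (hinverse u Y)"
    if "Y \<in> hreals u" for Y
    using that X by (auto simp: hreals_eq)
  have sub: "Y \<in> hreals u" if "Y \<in> hfin_units_pos u" for Y
    using that by (simp add: hfin_units_pos_def hpos_def)
  have surj: "hinverse u ` hfin_units_pos u = hfin_units_pos u"
    using inv inv2 sub by (metis (no_types, lifting) image_eqI image_subsetI subsetI subset_antisym)
  have "pinverse u (orbit u X) = (\<lambda>Y. hmult u (hinverse u X) (hinverse u Y)) ` hfin_units_pos u"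
    by (auto simp: pinverse_def orbit_def image_image mult sub cong: image_cong)
  also have "\<dots> = hmult u (hinverse u X) ` (hinverse u ` hfin_units_pos u)"
    by (simp add: image_image)
  finally show ?thesis by (simp add: surj orbit_def)
qed

lemma pmult_orbit:
  assumes u: "nonprincipal_ultrafilter u" and X: "X \<in> hreals u" and Y: "Y \<in> hreals u"
  shows "pmult u (orbit u X) (orbit u Y) = orbit u (hmult u X Y)"
proof -
  obtain x y where xy: "X = ucls u x" "Y = ucls u y" using X Y by (auto simp: hreals_eq)
  have sub: "\<exists>v. V = ucls u v" if "V \<in> hfin_units_pos u" for V
    using that by (auto simp: hfin_units_pos_def hpos_def hreals_eq)
  show ?thesis
  proof (intro set_eqI iffI)
    fix Z assume "Z \<in> pmult u (orbit u X) (orbit u Y)"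
    then obtain V W where VW: "V \<in> hfin_units_pos u" "W \<in> hfin_units_pos u"
      and Z: "Z = hmult u (hmult u X V) (hmult u Y W)" by (auto simp: pmult_def orbit_def)
    obtain v w where vw: "V = ucls u v" "W = ucls u w" using sub VW by blast
    obtain a b where ab: "a > 0" "b > 0" "eventually (\<lambda>i. a \<le> v i \<and> v i \<le> b) u"
      using VW(1) u by (auto simp: vw hfin_units_pos_ucls)
    obtain c d where cd: "c > 0" "d > 0" "eventually (\<lambda>i. c \<le> w i \<and> w i \<le> d) u"
      using VW(2) u by (auto simp: vw hfin_units_pos_ucls)
    have "eventually (\<lambda>i. a * c \<le> v i * w i \<and> v i * w i \<le> b * d) u"
      using ab(3) cd(3) by eventually_elim (use ab cd in \<open>auto intro!: mult_mono\<close>)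
    then have "ucls u (\<lambda>i. v i * w i) \<in> hfin_units_pos u"
      using ab cd mult_pos_pos[of a c] mult_pos_pos[of b d]
      unfolding hfin_units_pos_ucls[OF u] by blast
    moreover have "Z = hmult u (hmult u X Y) (ucls u (\<lambda>i. v i * w i))"
      by (simp add: Z xy vw algebra_simps)
    ultimately show "Z \<in> orbit u (hmult u X Y)" by (auto simp: orbit_def)
  next
    fix Z assume "Z \<in> orbit u (hmult u X Y)"
    then obtain V where V: "V \<in> hfin_units_pos u" and Z: "Z = hmult u (hmult u X Y) V"
      by (auto simp: orbit_def)
    have one: "ucls u (\<lambda>_. 1) \<in> hfin_units_pos u"
      using u by (auto simp: hfin_units_pos_ucls intro!: exI[of _ 1])
    obtain v where v: "V = ucls u v" using sub V by blast
    have "Z = hmult u (hmult u X V) (hmult u Y (ucls u (\<lambda>_. 1)))"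
      by (simp add: Z xy v algebra_simps)
    then show "Z \<in> pmult u (orbit u X) (orbit u Y)"
      using V one unfolding pmult_def orbit_def by blast
  qed
qed

lemma pmult_pinverse:
  assumes u: "nonprincipal_ultrafilter u" and X: "X \<in> hpos u"
  shows "pmult u (orbit u X) (pinverse u (orbit u X)) = orbit u (hconst u 1)"
proof -
  obtain x where x: "X = ucls u x" and pos: "eventually (\<lambda>i. 0 < x i) u"
    using X by (auto simp: hpos_def hreals_eq hconst_def)
  have "hmult u X (hinverse u X) = hconst u 1"
    unfolding x hconst_def lift1_ucls lift2_ucls ucls_eq_iff
    using pos by eventually_elim simp
  then show ?thesis
    using u by (simp add: x pinverse_orbit pmult_orbit hreals_eq)
qed

end

theory Submission
  imports Defs
begin

text \<open>
  If \<open>\<theta> = p / q\<close>, the standard integer \<open>q\<close> has decay \<open>-\<infinity>\<close> and finite growth, so it lies in every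
  group. If \<open>\<theta>\<close> is irrational, take \<open>\<mu> = \<langle>1 / (i + 1)\<rangle>\<close>, so that growth above \<open>\<mu>\<close> forces
  \<open>\<bar>n\<^sub>i\<bar> < i + 1\<close>; the distances from \<open>k \<theta>\<close> to the integers, \<open>0 < \<bar>k\<bar> \<le> i + 1\<close>, have a positive
  minimum, and \<open>\<nu>\<close> is chosen smaller than it by the infinite factor \<open>i + 1\<close>.
\<close>

text \<open>Otherwise the ultrafilter dichotomy makes \<open>{k}\<close> large; then
  \<open>eventually P u\<close> just means \<open>P k\<close>, so \<open>u\<close> is the principal
  filter at \<open>k\<close>.\<close>

lemma nonprincipal_ultrafilter_eventually_neq:
  assumes "nonprincipal_ultrafilter u"
  shows "eventually (\<lambda>i. i \<noteq> k) u"
proof (rule ccontr)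
  assume "\<not> eventually (\<lambda>i. i \<noteq> k) u"
  then have k: "eventually (\<lambda>i. i = k) u"
    using assms by (auto simp: nonprincipal_ultrafilter_def dest: spec[of _ "\<lambda>i. i = k"])
  have "eventually P u \<longleftrightarrow> P k" for P
  proof
    assume "P k"
    with k show "eventually P u" by (auto elim: eventually_mono)
  next
    assume "eventually P u"
    with k have "eventually (\<lambda>i. P k) u" by eventually_elim simp
    then show "P k" using assms by (auto simp: nonprincipal_ultrafilter_def)
  qed
  then have "u = principal {k}" by (simp add: filter_eq_iff eventually_principal)
  then show False using assms by (simp add: nonprincipal_ultrafilter_def)
qed

text \<open>Only finitely many indices lie below a natural number exceeding \<open>b\<close>, and
  each can be excluded. Hence the class of the identity sequence is an infinite hyperreal, the
  source of every infinitesimal built below.\<close>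

lemma nonprincipal_ultrafilter_eventually_gt:
  assumes u: "nonprincipal_ultrafilter u"
  shows "eventually (\<lambda>i. b < real i) u"
proof -
  obtain N :: nat where N: "b < real N" using reals_Archimedean2 by blast
  have "eventually (\<lambda>i. \<forall>k\<in>{..<N}. i \<noteq> k) u"
    using nonprincipal_ultrafilter_eventually_neq[OF u] by (subst eventually_ball_finite_distrib) auto
  then show ?thesis
  proof eventually_elim
    case (elim i)
    then have "N \<le> i" by (metis lessThan_iff not_le)
    then show ?case using N by linarith
  qed
qed

text \<open>Translates the quotient defining \<open>PP\<close> into sequences: representatives of a
  class differ by a factor \<open>w\<close> that is almost everywhere between two positive standard
  reals. All comparisons of classes below are made through such bounds.\<close>

lemma mem_orbit_ucls:
  assumes u: "nonprincipal_ultrafilter u"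
  shows "Y \<in> orbit u (ucls u x) \<longleftrightarrow>
    (\<exists>w a b. 0 < a \<and> 0 < b \<and> eventually (\<lambda>i. a \<le> w i \<and> w i \<le> b) u \<and> Y = ucls u (\<lambda>i. x i * w i))"
    (is "?L \<longleftrightarrow> ?R")
proof
  assume ?L
  then obtain V where V: "V \<in> hfin_units_pos u" "Y = hmult u (ucls u x) V" by (auto simp: orbit_def)
  moreover from V(1) obtain w where "V = ucls u w"
    by (auto simp: hfin_units_pos_def hpos_def hreals_eq)
  ultimately show ?R using hfin_units_pos_ucls[OF u, of w] by auto
next
  assume ?R
  then obtain w where "ucls u w \<in> hfin_units_pos u" "Y = hmult u (ucls u x) (ucls u w)"
    unfolding hfin_units_pos_ucls[OF u] by auto
  then show ?L unfolding orbit_def by blast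
qed

lemma ucls_mem_orbit:
  assumes "nonprincipal_ultrafilter u"
  shows "ucls u x \<in> orbit u (ucls u x)"
  unfolding mem_orbit_ucls[OF assms]
  by (rule exI[of _ "\<lambda>_. 1"], rule exI[of _ 1], rule exI[of _ 1]) simp

text \<open>The order on classes quantifies over all representatives, so it can be tested at the two
  generators themselves.\<close>

lemma pless_orbit_uclsD:
  assumes u: "nonprincipal_ultrafilter u" and "pless u (orbit u (ucls u x)) (orbit u (ucls u y))"
  shows "eventually (\<lambda>i. x i < y i) u"
proof -
  have "hless u (ucls u x) (ucls u y)"
    using assms(2) ucls_mem_orbit[OF u] unfolding pless_def by blast
  then show ?thesis by simp
qed

lemma hpos_ucls: "ucls u x \<in> hpos u \<longleftrightarrow> eventually (\<lambda>i. 0 < x i) u"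
  by (simp add: hpos_def hreals_eq hconst_def)

lemma hinfinitesimal_ucls:
  "ucls u x \<in> hinfinitesimal u \<longleftrightarrow> (\<forall>r>0. eventually (\<lambda>i. \<bar>x i\<bar> < r) u)"
  by (simp add: hinfinitesimal_def hreals_eq hconst_def)

text \<open>Domination by \<open>1 / (i + 1)\<close> forces infinitesimality, since \<open>i\<close>
  eventually exceeds \<open>1 / r\<close> for each standard \<open>r > 0\<close>.\<close>

lemma orbit_mem_PP_eps:
  assumes u: "nonprincipal_ultrafilter u"
    and x: "\<And>i. 0 < x i" "\<And>i. x i \<le> 1 / real (Suc i)"
  shows "orbit u (ucls u x) \<in> PP_eps u"
proof -
  have "eventually (\<lambda>i. \<bar>x i\<bar> < r) u" if r: "r > 0" for r
    using nonprincipal_ultrafilter_eventually_gt[OF u, of "1 / r"]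
  proof eventually_elim
    case (elim i)
    then have "1 / r < real (Suc i)" by simp
    then have "1 / real (Suc i) < r" using r by (simp add: field_simps)
    then show ?case using x[of i] by linarith
  qed
  then show ?thesis using x(1) by (auto simp: PP_eps_def hpos_ucls hinfinitesimal_ucls)
qed

lemma growth_ucls:
  assumes "nonprincipal_ultrafilter u"
  shows "growth u (ucls u x) = orbit u (ucls u (\<lambda>i. inverse \<bar>x i\<bar>))"
  using assms by (simp add: growth_def pclass_def pinverse_orbit hreals_eq)

text \<open>Evaluates the definite description in \<open>perp\<close>: by
  \<open>perp_unique\<close>, any integer sequence \<open>m\<close> with infinitesimal error
  represents the value, so \<open>m\<close> can be chosen at will.\<close>

lemma err_ucls:
  assumes u: "nonprincipal_ultrafilter u" and m: "\<And>i. m i \<in> \<int>"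
    and inf: "ucls u (\<lambda>i. x i * \<theta> - m i) \<in> hinfinitesimal u"
  shows "err u \<theta> (ucls u x) = ucls u (\<lambda>i. x i * \<theta> - m i)"
proof -
  have "perp u \<theta> (ucls u x) = ucls u m"
    unfolding perp_def
  proof (rule the_equality)
    show *: "ucls u m \<in> hints u \<and> hminus u (hmult u (ucls u x) (hconst u \<theta>)) (ucls u m) \<in> hinfinitesimal u"
      using m inf by (auto simp: hints_eq hconst_def)
    show "M = ucls u m"
      if "M \<in> hints u \<and> hminus u (hmult u (ucls u x) (hconst u \<theta>)) M \<in> hinfinitesimal u" for M
      by (rule perp_unique[OF u]) (use * that in \<open>auto simp: hreals_eq\<close>)
  qed
  then show ?thesis by (simp add: err_def hconst_def)
qed

text \<open>Only finitely many integers \<open>n\<close> are involved, and for each the nearest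
  integer to \<open>n * \<theta>\<close> gives the smallest distance. A zero distance would make
  \<theta> a quotient of integers, so the minimum is positive.\<close>

lemma irrational_dist_Ints_lower_bound:
  fixes \<theta> :: real
  assumes "\<theta> \<notin> \<rat>"
  shows "\<exists>d>0. \<forall>n\<in>\<int>. \<forall>m\<in>\<int>. n \<noteq> 0 \<longrightarrow> \<bar>n\<bar> \<le> real N \<longrightarrow> d \<le> \<bar>n * \<theta> - m\<bar>"
proof -
  define f where "f k = \<bar>of_int k * \<theta> - of_int (round (of_int k * \<theta>))\<bar>" for k :: int
  define S where "S = {- int N..int N} - {0}"
  \<comment> \<open>The extra element 1 keeps the set nonempty when \<open>N = 0\<close>, where
    \<open>S\<close> is empty.\<close>
  define d where "d = Min (insert 1 (f ` S))"
  have "f k > 0" if "k \<noteq> 0" for k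
  proof (rule ccontr)
    assume "\<not> f k > 0"
    then have "of_int k * \<theta> = of_int (round (of_int k * \<theta>))" by (simp add: f_def)
    then have "\<theta> = of_int (round (of_int k * \<theta>)) / of_int k" using that by (simp add: field_simps)
    then show False using assms by (metis Rats_divide Rats_of_int)
  qed
  then have "d > 0" by (simp add: d_def S_def)
  moreover have "d \<le> \<bar>n * \<theta> - m\<bar>" if nm: "n \<in> \<int>" "m \<in> \<int>" "n \<noteq> 0" "\<bar>n\<bar> \<le> real N" for n m
  proof -
    obtain k l where kl: "n = of_int k" "m = of_int l" using nm(1,2) by (auto elim!: Ints_cases)
    have "k \<in> S" using nm(3,4) by (simp add: S_def kl) linarith
    then have "d \<le> f k" by (simp add: d_def S_def)
    also have "\<dots> \<le> \<bar>n * \<theta> - m\<bar>"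
      unfolding f_def kl using round_diff_minimal[of "of_int k * \<theta>" l] by simp
    finally show ?thesis .
  qed
  ultimately show ?thesis by blast
qed

lemma Rats_imp_growth_decay_group_nontrivial:
  assumes u: "nonprincipal_ultrafilter u" and \<theta>: "\<theta> \<in> \<rat>"
    and \<mu>: "\<mu> \<in> PP_eps u" and \<nu>: "\<nu> \<in> PP_eps u"
  shows "growth_decay_group u \<theta> \<mu> \<nu> \<noteq> {hconst u 0}"
proof -
  obtain p q :: int where q: "q > 0" and \<theta>_eq: "\<theta> = of_int p / of_int q"
    using Rats_cases'[OF \<theta>] by metis
  let ?n = "ucls u (\<lambda>_. real_of_int q)"
  have n0: "?n \<noteq> hconst u 0"
    using q u by (auto simp: hconst_def ucls_eq_iff nonprincipal_ultrafilter_def)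
  have zero: "(\<lambda>i. real_of_int q * \<theta> - real_of_int p) = (\<lambda>_. 0)"
    using q by (simp add: \<theta>_eq)
  have inf: "ucls u (\<lambda>i. real_of_int q * \<theta> - real_of_int p) \<in> hinfinitesimal u"
    unfolding zero by (simp add: hinfinitesimal_ucls)
  have "?n \<in> hints_approx u \<theta>"
    unfolding hints_approx_def
  proof (intro CollectI conjI bexI[of _ "ucls u (\<lambda>_. real_of_int p)"])
    show "hminus u (hmult u ?n (hconst u \<theta>)) (ucls u (\<lambda>_. real_of_int p)) \<in> hinfinitesimal u"
      using inf by (simp add: hconst_def)
  qed (auto simp: hints_eq)
  moreover have "pless u \<mu> (growth u ?n)"
    unfolding pless_def growth_ucls[OF u]
  proof (intro ballI)
    fix X Y assume X: "X \<in> \<mu>" and Y: "Y \<in> orbit u (ucls u (\<lambda>i. inverse \<bar>real_of_int q\<bar>))"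
    obtain x where x: "\<mu> = orbit u (ucls u x)" "eventually (\<lambda>i. 0 < x i) u"
        "\<And>r. r > 0 \<Longrightarrow> eventually (\<lambda>i. \<bar>x i\<bar> < r) u"
      using \<mu> unfolding PP_eps_def by (auto simp: hpos_def hreals_eq hconst_def hinfinitesimal_ucls)
    obtain v b where v: "0 < b" "eventually (\<lambda>i. v i \<le> b) u" "X = ucls u (\<lambda>i. x i * v i)"
      using X unfolding x(1) mem_orbit_ucls[OF u] by (auto simp: eventually_conj_iff)
    obtain w a where w: "0 < a" "eventually (\<lambda>i. a \<le> w i) u"
        "Y = ucls u (\<lambda>i. inverse \<bar>real_of_int q\<bar> * w i)"
      using Y unfolding mem_orbit_ucls[OF u] by (auto simp: eventually_conj_iff)
    \<comment> \<open>Arbitrary representatives are \<open>x * v\<close> with \<open>v\<close> at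
      most \<open>b\<close>, and \<open>w / q\<close> with \<open>w\<close> at least
      \<open>a\<close>. The threshold \<open>a / (q * b)\<close> is a positive standard real, so the
      infinitesimal \<open>x\<close> falls below it, which absorbs both multipliers.\<close>
    have "eventually (\<lambda>i. \<bar>x i\<bar> < inverse (of_int q) * a / b) u"
      using q v(1) w(1) by (intro x(3)) simp
    with x(2) v(2) w(2) have "eventually (\<lambda>i. x i * v i < inverse \<bar>real_of_int q\<bar> * w i) u"
    proof eventually_elim
      case (elim i)
      have "x i * v i \<le> x i * b" using elim by (intro mult_left_mono) auto
      also have "\<dots> < inverse (of_int q) * a" using elim v(1) by (simp add: pos_less_divide_eq)
      also have "\<dots> \<le> inverse \<bar>real_of_int q\<bar> * w i" using elim q by simp
      finally show ?case .
    qed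
    then show "hless u X Y" by (simp add: v w)
  qed
  \<comment> \<open>The error is exactly 0, and the orbit of 0 contains only 0, whereas every
    representative of \<nu> is positive; so the strict alternative of \<open>pleq\<close>
    holds.\<close>
  moreover have "pless u (decay u \<theta> ?n) \<nu>"
    unfolding pless_def decay_def err_ucls[OF u Ints_of_int inf] unfolding zero pclass_def
  proof (intro ballI)
    fix X Y assume X: "X \<in> orbit u (habs u (ucls u (\<lambda>_. 0)))" and Y: "Y \<in> \<nu>"
    obtain y where y: "\<nu> = orbit u (ucls u y)" "eventually (\<lambda>i. 0 < y i) u"
      using \<nu> unfolding PP_eps_def by (auto simp: hpos_def hreals_eq hconst_def)
    obtain w a where w: "0 < a" "eventually (\<lambda>i. a \<le> w i) u" "Y = ucls u (\<lambda>i. y i * w i)"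
      using Y unfolding y(1) mem_orbit_ucls[OF u] by (auto simp: eventually_conj_iff)
    have "X = ucls u (\<lambda>_. 0)"
      using X by (auto simp: mem_orbit_ucls[OF u])
    moreover have "eventually (\<lambda>i. 0 < y i * w i) u"
      using y(2) w(2) by eventually_elim (use w(1) in auto)
    ultimately show "hless u X Y" by (simp add: w)
  qed
  ultimately have "?n \<in> growth_decay_group u \<theta> \<mu> \<nu>"
    using n0 by (simp add: growth_decay_group_def pleq_def)
  then show ?thesis using n0 by blast
qed

lemma irrational_imp_growth_decay_group_trivial:
  assumes u: "nonprincipal_ultrafilter u" and \<theta>: "\<theta> \<notin> \<rat>"
  shows "\<exists>\<mu>\<in>PP_eps u. \<exists>\<nu>\<in>PP_eps u. growth_decay_group u \<theta> \<mu> \<nu> = {hconst u 0}"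
proof -
  have "\<forall>i. \<exists>d>0. \<forall>n\<in>\<int>. \<forall>m\<in>\<int>. n \<noteq> 0 \<longrightarrow> \<bar>n\<bar> \<le> real (Suc i) \<longrightarrow> d \<le> \<bar>n * \<theta> - m\<bar>"
    using irrational_dist_Ints_lower_bound[OF \<theta>] by blast
  from choice[OF this] obtain d where d: "\<And>i. d i > 0"
    "\<And>i n m. n \<in> \<int> \<Longrightarrow> m \<in> \<int> \<Longrightarrow> n \<noteq> 0 \<Longrightarrow> \<bar>n\<bar> \<le> real (Suc i) \<Longrightarrow> d i \<le> \<bar>n * \<theta> - m\<bar>"
    by blast
  \<comment> \<open>Its reciprocal is \<open>Suc i\<close>, the cutoff used for \<open>d i\<close>;
    the successor avoids a division by zero at \<open>i = 0\<close>.\<close>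
  define x where "x i = 1 / real (Suc i)" for i
  \<comment> \<open>Capping at 1 keeps \<open>y\<close> below \<open>1 / (i + 1)\<close>, hence
    infinitesimal, however large the chosen \<open>d i\<close> may be.\<close>
  define y where "y i = min (d i) 1 / real (Suc i)" for i
  have y_pos: "0 < y i" for i using d(1) by (simp add: y_def)
  have \<mu>: "orbit u (ucls u x) \<in> PP_eps u"
    by (rule orbit_mem_PP_eps[OF u]) (auto simp: x_def)
  have \<nu>: "orbit u (ucls u y) \<in> PP_eps u"
    by (rule orbit_mem_PP_eps[OF u y_pos]) (auto simp: y_def intro!: divide_right_mono)
  have False if n: "n \<in> hints_approx u \<theta>" "n \<noteq> hconst u 0" "pless u (orbit u (ucls u x)) (growth u n)"
    "pleq u (decay u \<theta> n) (orbit u (ucls u y))" for n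
  proof -
    obtain k where k: "n = ucls u k" "\<And>i. k i \<in> \<int>"
      using n(1) by (auto simp: hints_approx_def hints_eq)
    obtain m where m: "\<And>i. m i \<in> \<int>" "ucls u (\<lambda>i. k i * \<theta> - m i) \<in> hinfinitesimal u"
      using n(1) by (auto simp: hints_approx_def hints_eq hconst_def k)
    let ?e = "\<lambda>i. \<bar>k i * \<theta> - m i\<bar>"
    have decay: "decay u \<theta> n = orbit u (ucls u ?e)"
      by (simp add: decay_def pclass_def k err_ucls[OF u m])
    have "\<not> eventually (\<lambda>i. k i = 0) u"
      using n(2) by (simp add: k hconst_def ucls_eq_iff)
    \<comment> \<open>The ultrafilter dichotomy upgrades "not almost everywhere zero" to "almost
      everywhere nonzero".\<close>
    then have k_nz: "eventually (\<lambda>i. k i \<noteq> 0) u"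
      using u by (auto simp: nonprincipal_ultrafilter_def)
    have "eventually (\<lambda>i. x i < inverse \<bar>k i\<bar>) u"
      using n(3) unfolding k(1) growth_ucls[OF u] by (rule pless_orbit_uclsD[OF u])
    \<comment> \<open>The growth condition puts \<open>k i\<close> within the range governed by
      \<open>d i\<close>, and \<open>y i * real (Suc i)\<close> is
      \<open>min (d i) 1\<close>.\<close>
    with k_nz have e_ge: "eventually (\<lambda>i. y i * real (Suc i) \<le> ?e i) u"
    proof eventually_elim
      case (elim i)
      then have "\<bar>k i\<bar> < real (Suc i)" by (simp add: x_def field_simps)
      then have "d i \<le> ?e i" using elim k m by (intro d(2)) auto
      then show ?case by (simp add: y_def)
    qed
    \<comment> \<open>Either alternative of \<open>pleq\<close> bounds the error by a standard
      multiple of \<open>y\<close>: strict inequality allows \<open>b = 1\<close>, while for equal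
      classes \<open>b\<close> is the upper bound of the factor relating the two
      representatives.\<close>
    obtain b where b: "eventually (\<lambda>i. ?e i \<le> y i * b) u"
    proof (cases "pless u (decay u \<theta> n) (orbit u (ucls u y))")
      case True
      then have "eventually (\<lambda>i. ?e i < y i) u"
        unfolding decay by (rule pless_orbit_uclsD[OF u])
      then have "eventually (\<lambda>i. ?e i \<le> y i * 1) u" by eventually_elim simp
      then show ?thesis by (rule that)
    next
      case False
      then have "ucls u ?e \<in> orbit u (ucls u y)"
        using n(4) ucls_mem_orbit[OF u, of ?e] by (simp add: pleq_def decay)
      then obtain w b where w: "eventually (\<lambda>i. w i \<le> b) u" "eventually (\<lambda>i. ?e i = y i * w i) u"
        unfolding mem_orbit_ucls[OF u] by (auto simp: eventually_conj_iff ucls_eq_iff)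
      then have "eventually (\<lambda>i. ?e i \<le> y i * b) u"
      proof eventually_elim
        case (elim i)
        then show ?case using y_pos[of i] by (simp add: mult_left_mono)
      qed
      then show ?thesis by (rule that)
    qed
    \<comment> \<open>Cancelling \<open>y i > 0\<close> between the two bounds leaves
      \<open>i + 1\<close> at most the standard real \<open>b\<close>, although \<open>i\<close>
      eventually exceeds \<open>b\<close>.\<close>
    have "eventually (\<lambda>i. False) u"
      using e_ge b nonprincipal_ultrafilter_eventually_gt[OF u, of b]
    proof eventually_elim
      case (elim i)
      then have "y i * real (Suc i) \<le> y i * b" by linarith
      then have "real (Suc i) \<le> b" using y_pos[of i] mult_le_cancel_left_pos by blast
      then show ?case using elim(3) by simp
    qed
    then show False using u by (simp add: nonprincipal_ultrafilter_def trivial_limit_def)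
  qed
  then have "growth_decay_group u \<theta> (orbit u (ucls u x)) (orbit u (ucls u y)) = {hconst u 0}"
    unfolding growth_decay_group_def by blast
  then show ?thesis using \<mu> \<nu> by blast
qed

theorem proposition10:
  fixes u :: "nat filter" and \<theta> :: real
  assumes "nonprincipal_ultrafilter u"
  shows "\<theta> \<in> \<rat> \<longleftrightarrow> Spec u \<theta> = PP_eps u \<times> PP_eps u"
proof
  assume "\<theta> \<in> \<rat>"
  then show "Spec u \<theta> = PP_eps u \<times> PP_eps u"
    using Rats_imp_growth_decay_group_nontrivial[OF assms] by (auto simp: Spec_def)
next
  assume Spec: "Spec u \<theta> = PP_eps u \<times> PP_eps u"
  show "\<theta> \<in> \<rat>"
  proof (rule ccontr)
    assume "\<theta> \<notin> \<rat>"
    then obtain \<mu> \<nu> where "\<mu> \<in> PP_eps u" "\<nu> \<in> PP_eps u"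
        and trivial: "growth_decay_group u \<theta> \<mu> \<nu> = {hconst u 0}"
      using irrational_imp_growth_decay_group_trivial[OF assms] by blast
    then have "(\<mu>, \<nu>) \<in> Spec u \<theta>" by (simp add: Spec)
    then show False by (simp add: Spec_def trivial)
  qed
qed

end
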